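(* Consider the loss-only experts problem with $N$ experts: an oblivious adversary fixes loss vectors $\ell_1,\dots,\ell_T\in[0,1]^N$; at round $t$ the learner picks $i_t\in[N]$, incurs $\ell_{t,i_t}$ and then observes $\ell_t$. Let $L_{t}=\sum_{s\le t}\ell_s$ and $L_T^*=\min_i L_{T,i}$. The follow-the-perturbed-leader (FTPL) algorithm with perturbation distribution $\mathcal{D}$ plays $i_t$ drawn from $p_t=\nabla\tilde\Phi_{\mathcal{D}}(L_{t-1})$, where $\tilde\Phi_{\mathcal{D}}(L)=\mathbb{E}_{Z_1,\dots,Z_N\sim\mathcal{D}\text{ i.i.d.}}[\min_i(L_i-Z_i)]$, i.e. $p_{t,i}=\mathbb{P}(i=\arg\min_{i'}(L_{t-1,i'}-Z_{i'}))$. Then FTPL with Gamma, Gumbel, Fréchet, Weibull, and Pareto perturbations, each with a proper choice of distribution parameters, achieves expected regret $\mathbb{E}[\sum_{t=1}^T\ell_{t,i_t}]-L_T^*=O(\sqrt{L_T^*\log N}+\log N)$.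
   Context: The distribution parameters (including a scale parameter) may be chosen depending on $N$ and $L_T^*$. Expectation is over the learner's randomness. *)

theory Defs
  imports "HOL-Probability.Probability"
begin

text \<open>Loss vectors: \<open>l t i\<close> is the loss of expert \<open>i < N\<close> in round \<open>t \<in> {1..T}\<close>.\<close>

definition cum_loss :: "(nat \<Rightarrow> nat \<Rightarrow> real) \<Rightarrow> nat \<Rightarrow> nat \<Rightarrow> real" where
  "cum_loss l t i = (\<Sum>s\<in>{1..t}. l s i)"

definition best_loss :: "nat \<Rightarrow> (nat \<Rightarrow> nat \<Rightarrow> real) \<Rightarrow> nat \<Rightarrow> real" where
  "best_loss N l T = Min ((\<lambda>i. cum_loss l T i) ` {..<N})"

text \<open>Probability (under i.i.d. perturbations \<open>Z_1..Z_N \<sim> D\<close>) that expert \<open>i\<close> is the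
  minimiser of \<open>L_i' - Z_i'\<close>; ties (a null event for continuous \<open>D\<close>) are broken towards the
  smallest index.\<close>

definition ftpl_prob :: "real measure \<Rightarrow> nat \<Rightarrow> (nat \<Rightarrow> real) \<Rightarrow> nat \<Rightarrow> real" where
  "ftpl_prob D N L i =
     measure (PiM {..<N} (\<lambda>_. D))
       {z \<in> space (PiM {..<N} (\<lambda>_. D)).
          (\<forall>j<N. L i - z i \<le> L j - z j) \<and> (\<forall>j<i. L i - z i < L j - z j)}"

definition ftpl_regret :: "real measure \<Rightarrow> nat \<Rightarrow> nat \<Rightarrow> (nat \<Rightarrow> nat \<Rightarrow> real) \<Rightarrow> real" where
  "ftpl_regret D N T l =
     (\<Sum>t\<in>{1..T}. \<Sum>i<N. ftpl_prob D N (cum_loss l (t - 1)) i * l t i) - best_loss N l T"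

definition ftpl_achieves_bound :: "('p \<Rightarrow> real \<Rightarrow> real) \<Rightarrow> ('p \<Rightarrow> bool) \<Rightarrow> bool" where
  "ftpl_achieves_bound pdf valid \<longleftrightarrow>
     (\<exists>C::real. \<exists>\<theta>::nat \<Rightarrow> real \<Rightarrow> 'p.
        (\<forall>N Lstar. valid (\<theta> N Lstar)) \<and>
        (\<forall>N T (l::nat \<Rightarrow> nat \<Rightarrow> real). N \<ge> 1 \<longrightarrow> (\<forall>t i. 0 \<le> l t i \<and> l t i \<le> 1) \<longrightarrow>
           ftpl_regret (density lborel (\<lambda>x. ennreal (pdf (\<theta> N (best_loss N l T)) x))) N T l
             \<le> C * (sqrt (best_loss N l T * ln (real N)) + ln (real N))))"

definition gamma_pdf :: "real \<times> real \<Rightarrow> real \<Rightarrow> real" where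
  "gamma_pdf = (\<lambda>(a, b) x. if x > 0 then x powr (a - 1) * exp (- x / b) / (Gamma a * b powr a) else 0)"
definition gamma_valid :: "real \<times> real \<Rightarrow> bool" where
  "gamma_valid = (\<lambda>(a, b). a > 0 \<and> b > 0)"

definition gumbel_pdf :: "real \<times> real \<Rightarrow> real \<Rightarrow> real" where
  "gumbel_pdf = (\<lambda>(m, b) x. exp (- ((x - m) / b + exp (- (x - m) / b))) / b)"
definition gumbel_valid :: "real \<times> real \<Rightarrow> bool" where
  "gumbel_valid = (\<lambda>(m, b). b > 0)"

definition frechet_pdf :: "real \<times> real \<times> real \<Rightarrow> real \<Rightarrow> real" where
  "frechet_pdf = (\<lambda>(a, s, m) x. if x > m then
      (a / s) * ((x - m) / s) powr (- 1 - a) * exp (- (((x - m) / s) powr (- a))) else 0)"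
definition frechet_valid :: "real \<times> real \<times> real \<Rightarrow> bool" where
  "frechet_valid = (\<lambda>(a, s, m). a > 0 \<and> s > 0)"

definition weibull_pdf :: "real \<times> real \<Rightarrow> real \<Rightarrow> real" where
  "weibull_pdf = (\<lambda>(k, l) x. if x > 0 then
      (k / l) * (x / l) powr (k - 1) * exp (- ((x / l) powr k)) else 0)"
definition weibull_valid :: "real \<times> real \<Rightarrow> bool" where
  "weibull_valid = (\<lambda>(k, l). k > 0 \<and> l > 0)"

definition pareto_pdf :: "real \<times> real \<Rightarrow> real \<Rightarrow> real" where
  "pareto_pdf = (\<lambda>(a, xm) x. if x \<ge> xm then a * xm powr a / x powr (a + 1) else 0)"
definition pareto_valid :: "real \<times> real \<Rightarrow> bool" where
  "pareto_valid = (\<lambda>(a, xm). a > 0 \<and> xm > 0)"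

end

theory Submission
  imports Defs "HOL-Real_Asymp.Real_Asymp"
begin

text \<open>
  If the hazard rate of the perturbation is at most \<open>\<epsilon> \<le> 1/2\<close>, then raising the losses by at
  most 1 leaves each expert at least \<open>1 - \<epsilon>\<close> times its probability of leading, so FTPL is within
  a factor \<open>1 + 2\<epsilon>\<close> of the learner who already sees the loss of the current round. By telescoping,
  that learner suffers at most \<open>L\<^sup>* + E[max Z\<^sub>i] - E[Z\<^sub>k]\<close>, where \<open>k\<close> is the best expert; this
  excess is bounded by \<open>u + N E[(Z - u)\<^sup>+] + E[Z\<^sup>-]\<close> for any threshold \<open>u \<ge> 0\<close>. All five families
  contain members with hazard rate at most \<open>\<epsilon>\<close> and excess \<open>O(log N / \<epsilon>)\<close>: Gamma and Weibull of
  shape 1 (the exponential distribution) and Gumbel, all of scale \<open>1/\<epsilon>\<close>, and Frechet and Pareto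
  of shape \<open>2 + log N\<close> and scale proportional to \<open>(2 + log N) / \<epsilon>\<close>. Then tune
  \<open>\<epsilon> = min (1/2) (sqrt (log N / L\<^sup>*))\<close>.
\<close>

section \<open>Pathwise bounds for one fixed draw of the perturbations\<close>

definition leader :: "nat \<Rightarrow> (nat \<Rightarrow> real) \<Rightarrow> (nat \<Rightarrow> real) \<Rightarrow> nat \<Rightarrow> bool" where
  "leader N L z i \<longleftrightarrow> (\<forall>j<N. L i - z i \<le> L j - z j) \<and> (\<forall>j<i. L i - z i < L j - z j)"

text \<open>The least index among the minimisers is the only one that survives the tie-breaking
  clause. Uniqueness is stated as an equivalence so that sums weighted by
  \<open>of_bool (leader ...)\<close> collapse to a single term.\<close>

lemma leader_exists:
  assumes "N \<ge> 1"
  shows "\<exists>i<N. \<forall>k<N. leader N L z k \<longleftrightarrow> k = i"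
proof -
  let ?P = "\<lambda>i. i < N \<and> (\<forall>j<N. L i - z i \<le> L j - z j)"
  have "\<exists>i. ?P i"
    using ex_is_arg_min_if_finite[of "{..<N}" "\<lambda>i. L i - z i"] assms
    by (auto simp: is_arg_min_linorder lessThan_empty_iff)
  then have P: "?P (LEAST i. ?P i)" by (rule LeastI_ex)
  let ?i = "LEAST i. ?P i"
  have least: "L ?i - z ?i < L j - z j" if "j < ?i" for j
    using not_less_Least[OF that] P that by (meson less_trans not_le order_trans)
  show ?thesis
  proof (intro exI[of _ ?i] conjI allI impI iffI)
    fix k assume k: "k < N" "leader N L z k"
    show "k = ?i"
    proof (rule linorder_cases[of k ?i])
      assume "?i < k"
      then show ?thesis using k P by (force simp: leader_def)
    next
      assume "k < ?i"
      then show ?thesis using k P least[of k] by (force simp: leader_def)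
    qed
  next
    fix k assume "k < N" "k = ?i"
    then show "leader N L z k" using P least unfolding leader_def by blast
  qed (use P in blast)
qed

lemma be_the_leader:
  assumes "N \<ge> 1" "k < N"
  shows "(\<Sum>t\<in>{1..T}. \<Sum>i<N. l t i * of_bool (leader N (cum_loss l t) z i))
    \<le> cum_loss l T k + Max (z ` {..<N}) - z k"
  using assms(2)
proof (induction T arbitrary: k)
  case 0
  then show ?case by (simp add: cum_loss_def)
next
  case (Suc T)
  obtain i where i: "i < N" "\<And>k. k < N \<Longrightarrow> leader N (cum_loss l (Suc T)) z k \<longleftrightarrow> k = i"
    using leader_exists[OF assms(1)] by blast
  have "(\<Sum>k<N. l (Suc T) k * of_bool (leader N (cum_loss l (Suc T)) z k))
      = (\<Sum>k<N. if k = i then l (Suc T) k else 0)"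
    by (rule sum.cong) (auto simp: i(2))
  also have "\<dots> = l (Suc T) i"
    using i(1) by simp
  finally have "(\<Sum>t\<in>{1..Suc T}. \<Sum>i<N. l t i * of_bool (leader N (cum_loss l t) z i))
      \<le> cum_loss l T i + l (Suc T) i + Max (z ` {..<N}) - z i"
    using Suc.IH[OF i(1)] by simp
  also have "\<dots> = cum_loss l (Suc T) i - z i + Max (z ` {..<N})"
    by (simp add: cum_loss_def)
  also have "cum_loss l (Suc T) i - z i \<le> cum_loss l (Suc T) k - z k"
    using i Suc.prems by (auto simp: leader_def)
  finally show ?case by simp
qed

text \<open>After this bound only one-coordinate functions have to be integrated, so no distribution
  of a maximum is ever computed.\<close>

lemma Max_le_add_sum_excess:
  fixes z :: "nat \<Rightarrow> real"
  assumes "N \<ge> 1"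
  shows "Max (z ` {..<N}) \<le> u + (\<Sum>j<N. max (z j - u) 0)"
proof (subst Max_le_iff)
  have "z i \<le> u + (\<Sum>j<N. max (z j - u) 0)" if "i < N" for i
    using member_le_sum[of i "{..<N}" "\<lambda>j. max (z j - u) 0"] that by auto
  then show "\<forall>a\<in>z ` {..<N}. a \<le> u + (\<Sum>j<N. max (z j - u) 0)" by auto
qed (use assms in \<open>auto simp: lessThan_empty_iff\<close>)

section \<open>Bounded hazard rate and unit shifts\<close>

text \<open>The hazard rate of \<open>f\<close> at \<open>x\<close> is \<open>f x\<close> divided by the tail probability; multiplying out avoids
  the junk value of the quotient where the tail vanishes.\<close>

definition hazard_rate_le :: "real \<Rightarrow> (real \<Rightarrow> real) \<Rightarrow> bool" where
  "hazard_rate_le \<epsilon> f \<longleftrightarrow> f \<in> borel_measurable borel \<and>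
     prob_space (density lborel (\<lambda>x. ennreal (f x))) \<and>
     (AE x in lborel. f x \<le> \<epsilon> * measure (density lborel (\<lambda>x. ennreal (f x))) {x..})"

text \<open>The part \<open>W\<close> of the half-line \<open>S\<close> that is lost under a unit
  shift has length at most 1. At each of its points \<open>x\<close> the density is at most
  \<open>\<epsilon>\<close> times the mass of \<open>{x..}\<close>, which lies inside
  \<open>S\<close>. Upward closed sets cover open and closed half-lines at once; tie-breaking
  produces both.\<close>

lemma hazard_rate_le_shift:
  fixes f :: "real \<Rightarrow> real"
  defines "D \<equiv> density lborel (\<lambda>x. ennreal (f x))"
  assumes f: "hazard_rate_le \<epsilon> f" and [measurable]: "S \<in> sets borel"
    and "0 \<le> \<epsilon>"
    and up: "\<And>x y. x \<in> S \<Longrightarrow> x \<le> y \<Longrightarrow> y \<in> S"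
  shows "(1 - \<epsilon>) * measure D S \<le> measure D {x. x - 1 \<in> S}"
proof -
  have [measurable]: "f \<in> borel_measurable borel" and "prob_space D"
    and hazard: "AE x in lborel. f x \<le> \<epsilon> * measure D {x..}"
    using f by (auto simp: hazard_rate_le_def D_def)
  interpret prob_space D by fact
  have D[simp]: "sets D = sets borel" "space D = UNIV" by (auto simp: D_def)
  define W where "W = S - {x. x - 1 \<in> S}"
  have [measurable]: "{x. x - 1 \<in> S} \<in> sets borel"
    by measurable
  have W[measurable]: "W \<in> sets borel" unfolding W_def by measurable
  \<comment> \<open>Otherwise \<open>x \<le> y - 1\<close> would put \<open>y - 1\<close> into
    \<open>S\<close>, contradicting \<open>y \<in> W\<close>.\<close>
  have close: "y \<le> x + 1" if "x \<in> W" "y \<in> W" for x y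
    using that up[of x "y - 1"] by (force simp: W_def)
  have "W \<subseteq> {Inf W..Inf W + 1}"
  proof (cases "W = {}")
    case False
    then obtain w where w: "w \<in> W" by blast
    have "bdd_below W" using close[OF _ w] by (intro bdd_belowI[of _ "w - 1"]) force
    then have lower: "Inf W \<le> x" if "x \<in> W" for x using that by (rule cInf_lower[rotated])
    have "x - 1 \<le> Inf W" if "x \<in> W" for x
      using close[OF _ that] False by (intro cInf_greatest) force+
    with lower show ?thesis by force
  qed simp
  then have W1: "emeasure lborel W \<le> 1"
    using emeasure_mono[of W "{Inf W..Inf W + 1}" lborel] by simp
  have "emeasure D W = (\<integral>\<^sup>+x. ennreal (f x) * indicator W x \<partial>lborel)"
    unfolding D_def by (rule emeasure_density) simp_all
  also have "\<dots> \<le> (\<integral>\<^sup>+x. ennreal (\<epsilon> * measure D S) * indicator W x \<partial>lborel)"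
  proof (rule nn_integral_mono_AE, use hazard in eventually_elim)
    fix x assume x: "f x \<le> \<epsilon> * measure D {x..}"
    have "measure D {x..} \<le> measure D S" if "x \<in> S"
      using up[OF that] by (intro finite_measure_mono) auto
    then show "ennreal (f x) * indicator W x \<le> ennreal (\<epsilon> * measure D S) * indicator W x"
      using x \<open>0 \<le> \<epsilon>\<close>
      by (auto simp: indicator_def W_def intro!: ennreal_leI order_trans[OF x] mult_left_mono)
  qed
  also have "\<dots> = ennreal (\<epsilon> * measure D S) * emeasure lborel W"
    by (rule nn_integral_cmult_indicator) simp
  also have "\<dots> \<le> ennreal (\<epsilon> * measure D S)"
    using mult_left_mono[OF W1, of "ennreal (\<epsilon> * measure D S)"] by simp
  finally have "measure D W \<le> \<epsilon> * measure D S"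
    using \<open>0 \<le> \<epsilon>\<close> by (simp add: emeasure_eq_measure)
  moreover have "measure D S \<le> measure D (W \<union> {x. x - 1 \<in> S})"
    by (intro finite_measure_mono) (auto simp: W_def)
  moreover have "measure D (W \<union> {x. x - 1 \<in> S}) \<le> measure D W + measure D {x. x - 1 \<in> S}"
    by (rule measure_Un_le) simp_all
  ultimately show ?thesis by (simp add: algebra_simps)
qed

section \<open>From stability of the playing probabilities to a regret bound\<close>

lemma ftpl_prob_eq:
  "ftpl_prob D N L i = measure (PiM {..<N} (\<lambda>_. D)) {z \<in> space (PiM {..<N} (\<lambda>_. D)). leader N L z i}"
  unfolding ftpl_prob_def leader_def ..

lemma leader_set_measurable:
  assumes D: "sets D = sets borel" and "i < N"
  shows "{z \<in> space (PiM {..<N} (\<lambda>_. D)). leader N L z i} \<in> sets (PiM {..<N} (\<lambda>_. D))"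
proof -
  have "(\<lambda>z. z j) \<in> borel_measurable (PiM {..<N} (\<lambda>_. D))" if "j < N" for j
    using measurable_component_singleton[of j "{..<N}" "\<lambda>_. D"] that
    by (simp add: measurable_cong_sets[OF refl D])
  then have "{z \<in> space (PiM {..<N} (\<lambda>_. D)).
      (\<forall>j\<in>{..<N}. L i - z i \<le> L j - z j) \<and> (\<forall>j\<in>{..<i}. L i - z i < L j - z j)}
      \<in> sets (PiM {..<N} (\<lambda>_. D))"
    using \<open>i < N\<close>
    by (intro sets.sets_Collect_conj sets.sets_Collect_finite_All borel_measurable_le
        borel_measurable_less borel_measurable_diff) auto
  then show ?thesis unfolding leader_def Ball_def lessThan_iff .
qed

text \<open>Integrate over \<open>z i\<close> first, with the other perturbations fixed. The values
  of \<open>z i\<close> that make \<open>i\<close> the leader form an upward closed set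
  \<open>S\<close>. Passing from \<open>L\<close> to \<open>L'\<close> costs \<open>i\<close> at
  most 1, and higher losses of the competitors only help, so every point of the unit shift of
  \<open>S\<close> still makes \<open>i\<close> the leader.\<close>

lemma ftpl_prob_stable:
  assumes "prob_space D" and D: "sets D = sets borel" and i: "i < N" and "\<epsilon> \<le> 1"
    and shift: "\<And>S. S \<in> sets borel \<Longrightarrow> (\<And>x y. x \<in> S \<Longrightarrow> x \<le> y \<Longrightarrow> y \<in> S) \<Longrightarrow>
      (1 - \<epsilon>) * measure D S \<le> measure D {x. x - 1 \<in> S}"
    and L: "L' i \<le> L i + 1" "\<And>j. L j \<le> L' j"
  shows "(1 - \<epsilon>) * ftpl_prob D N L i \<le> ftpl_prob D N L' i"
proof -
  interpret D: prob_space D by fact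
  interpret product_sigma_finite "\<lambda>_::nat. D"
    by (intro product_sigma_finite.intro prob_space_imp_sigma_finite) fact
  interpret P: prob_space "PiM {..<N} (\<lambda>_. D)"
    by (rule prob_space_PiM) (rule assms(1))
  have D_UNIV: "space D = UNIV" using sets_eq_imp_space_eq[OF D] by simp
  let ?P = "PiM {..<N} (\<lambda>_. D)" and ?I = "{..<N} - {i}"
  let ?A = "\<lambda>L. {z \<in> space ?P. leader N L z i}"
  have I: "insert i ?I = {..<N}" using i by auto
  have A: "?A L \<in> sets ?P" for L using leader_set_measurable[OF D i] .
  have split: "(\<integral>\<^sup>+z. c * indicator (?A L) z \<partial>?P) =
      (\<integral>\<^sup>+x. (\<integral>\<^sup>+y. c * indicator (?A L) (x(i := y)) \<partial>D) \<partial>PiM ?I (\<lambda>_. D))" for c L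
    using product_nn_integral_insert[of ?I i "\<lambda>z. c * indicator (?A L) z", unfolded I] A[of L]
    by simp
  have "ennreal (1 - \<epsilon>) * emeasure ?P (?A L) = (\<integral>\<^sup>+z. ennreal (1 - \<epsilon>) * indicator (?A L) z \<partial>?P)"
    using A by (simp add: nn_integral_cmult_indicator)
  \<comment> \<open>The factor 1 is kept so that \<open>split\<close> rewrites both sides.\<close>
  also have "\<dots> \<le> (\<integral>\<^sup>+z. 1 * indicator (?A L') z \<partial>?P)"
    unfolding split
  proof (rule nn_integral_mono)
    fix x assume x: "x \<in> space (PiM ?I (\<lambda>_. D))"
    \<comment> \<open>The section of the leader event in direction \<open>i\<close>. The index
      \<open>j = i\<close> is left out because its condition is trivial, and \<open>x\<close> is
      only meaningful on the other coordinates.\<close>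
    define S where "S = {y. (\<forall>j\<in>?I. L i - y \<le> L j - x j) \<and> (\<forall>j\<in>{..<i}. L i - y < L j - x j)}"
    have S[measurable]: "S \<in> sets borel"
      unfolding S_def by measurable
    have xy: "x(i := y) \<in> space ?P" for y
      using x D_UNIV i by (auto simp: space_PiM PiE_def extensional_def)
    have S_eq: "y \<in> S \<longleftrightarrow> leader N L (x(i := y)) i" for y
      by (auto simp: S_def leader_def)
    have sub: "leader N L' (x(i := y)) i" if "y - 1 \<in> S" for y
      unfolding leader_def
    proof (intro conjI allI impI)
      fix j assume "j < N"
      then show "L' i - (x(i := y)) i \<le> L' j - (x(i := y)) j"
        using that L(1) L(2)[of j] by (cases "j = i") (force simp: S_def)+
    next
      fix j assume "j < i"
      then show "L' i - (x(i := y)) i < L' j - (x(i := y)) j"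
        using that L(1) L(2)[of j] by (force simp: S_def)
    qed
    have m1: "{x. x - 1 \<in> S} \<in> sets borel" by measurable
    have "(\<integral>\<^sup>+y. ennreal (1 - \<epsilon>) * indicator (?A L) (x(i := y)) \<partial>D)
        = (\<integral>\<^sup>+y. ennreal (1 - \<epsilon>) * indicator S y \<partial>D)"
      using xy by (intro nn_integral_cong) (auto simp: S_eq indicator_def)
    also have "\<dots> = ennreal ((1 - \<epsilon>) * measure D S)"
      using S \<open>\<epsilon> \<le> 1\<close> D by (simp add: nn_integral_cmult_indicator D.emeasure_eq_measure ennreal_mult)
    also have "\<dots> \<le> ennreal (measure D {x. x - 1 \<in> S})"
    proof (intro ennreal_leI shift S)
      fix a b assume ab: "a \<in> S" "a \<le> b"
      then show "b \<in> S" unfolding S_def by force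
    qed
    also have "\<dots> = (\<integral>\<^sup>+y. indicator {x. x - 1 \<in> S} y \<partial>D)"
      using m1 D by (simp add: D.emeasure_eq_measure)
    also have "\<dots> \<le> (\<integral>\<^sup>+y. 1 * indicator (?A L') (x(i := y)) \<partial>D)"
      using xy sub by (intro nn_integral_mono) (auto simp: indicator_def)
    finally show "(\<integral>\<^sup>+y. ennreal (1 - \<epsilon>) * indicator (?A L) (x(i := y)) \<partial>D)
        \<le> (\<integral>\<^sup>+y. 1 * indicator (?A L') (x(i := y)) \<partial>D)" .
  qed
  also have "\<dots> = emeasure ?P (?A L')" using A by simp
  finally have "(1 - \<epsilon>) * measure ?P (?A L) \<le> measure ?P (?A L')"
    using \<open>\<epsilon> \<le> 1\<close> by (simp add: P.emeasure_eq_measure flip: ennreal_mult)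
  then show ?thesis by (simp add: ftpl_prob_eq)
qed

text \<open>The expectation of \<open>be_the_leader\<close> against the best expert bounds the
  learner who sees one round ahead; stability, applied round by round, transfers this to FTPL at the
  price of a factor \<open>1 + 2 * \<epsilon>\<close>.\<close>

lemma ftpl_regret_le:
  assumes "prob_space D" and D: "sets D = sets borel" and N: "N \<ge> 1"
    and \<epsilon>: "0 \<le> \<epsilon>" "\<epsilon> \<le> 1/2"
    and shift: "\<And>S. S \<in> sets borel \<Longrightarrow> (\<And>x y. x \<in> S \<Longrightarrow> x \<le> y \<Longrightarrow> y \<in> S) \<Longrightarrow>
      (1 - \<epsilon>) * measure D S \<le> measure D {x. x - 1 \<in> S}"
    and l: "\<And>t i. 0 \<le> l t i" "\<And>t i. l t i \<le> 1"
    and u: "0 \<le> u" "integrable D (\<lambda>z. max (z - u) 0)"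
    and neg: "integrable D (\<lambda>z. max (- z) 0)"
  shows "ftpl_regret D N T l \<le> 2 * \<epsilon> * best_loss N l T +
    2 * (u + real N * (LINT z|D. max (z - u) 0) + (LINT z|D. max (- z) 0))"
proof -
  interpret P: prob_space "PiM {..<N} (\<lambda>_. D)"
    by (rule prob_space_PiM) (rule assms(1))
  let ?P = "PiM {..<N} (\<lambda>_. D)"
  let ?p = "\<lambda>t i. ftpl_prob D N (cum_loss l t) i"
  define B where "B = u + real N * (LINT z|D. max (z - u) 0) + (LINT z|D. max (- z) 0)"
  have B: "0 \<le> B" unfolding B_def using u by simp
  have best0: "0 \<le> best_loss N l T"
    using N l by (auto simp: best_loss_def cum_loss_def lessThan_empty_iff intro!: sum_nonneg)
  have "best_loss N l T \<in> (\<lambda>i. cum_loss l T i) ` {..<N}"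
    unfolding best_loss_def using N by (intro Min_in) (auto simp: lessThan_empty_iff)
  then obtain k where k: "k < N" "best_loss N l T = cum_loss l T k" by auto
  \<comment> \<open>Each coordinate of the product has marginal \<open>D\<close>.\<close>
  have comp: "integrable ?P (\<lambda>z. g (z j))" "(LINT z|?P. g (z j)) = (LINT z|D. g z)"
    if "j < N" "integrable D g" for g :: "real \<Rightarrow> real" and j
  proof -
    have distr: "distr ?P D (\<lambda>z. z j) = D"
      using distr_PiM_component[of "{..<N}" "\<lambda>_. D" j] that assms(1) by simp
    have meas: "(\<lambda>z. z j) \<in> measurable ?P D"
      using that by simp
    show "integrable ?P (\<lambda>z. g (z j))"
      using integrable_distr[OF meas, of g] that distr by simp
    show "(LINT z|?P. g (z j)) = (LINT z|D. g z)"
      using integral_distr[OF meas, of g] that distr by simp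
  qed
  have A: "{z \<in> space ?P. leader N L z i} \<in> sets ?P" if "i < N" for i L
    using leader_set_measurable[OF D that] .
  have ind: "integrable ?P (\<lambda>z. of_bool (leader N L z i) :: real)"
      "(LINT z|?P. of_bool (leader N L z i)) = ftpl_prob D N L i" if "i < N" for i L
  proof -
    have "integrable ?P (\<lambda>z. of_bool (leader N L z i) :: real) \<longleftrightarrow>
        integrable ?P (indicator {z \<in> space ?P. leader N L z i} :: _ \<Rightarrow> real)"
      by (intro Bochner_Integration.integrable_cong refl) (simp add: indicator_def)
    then show "integrable ?P (\<lambda>z. of_bool (leader N L z i) :: real)"
      using A[OF that] by (simp add: P.emeasure_eq_measure)
    have "(LINT z|?P. of_bool (leader N L z i)) =
        (LINT z|?P. indicator {z \<in> space ?P. leader N L z i} z :: real)"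
      by (intro Bochner_Integration.integral_cong refl) (simp add: indicator_def)
    then show "(LINT z|?P. of_bool (leader N L z i)) = ftpl_prob D N L i"
      using A[OF that] by (simp add: ftpl_prob_eq)
  qed
  have lhs_int: "integrable ?P (\<lambda>z. \<Sum>t\<in>{1..T}. \<Sum>i<N. l t i * of_bool (leader N (cum_loss l t) z i))"
    using ind(1) by (intro Bochner_Integration.integrable_sum integrable_mult_right) auto
  have rhs_int: "integrable ?P (\<lambda>z. \<Sum>j<N. max (z j - u) 0)"
    using comp(1)[OF _ u(2)] by (intro Bochner_Integration.integrable_sum) auto
  have term_int: "integrable ?P (\<lambda>z. l t i * of_bool (leader N L z i))" if "i < N" for t i L
    using ind(1)[OF that] by simp
  have inner: "(LINT z|?P. (\<Sum>i<N. l t i * of_bool (leader N L z i))) =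
      (\<Sum>i<N. l t i * ftpl_prob D N L i)" for t L
    by (subst Bochner_Integration.integral_sum) (use term_int ind(2) in auto)
  have "(\<Sum>t\<in>{1..T}. \<Sum>i<N. l t i * ?p t i) =
      (LINT z|?P. (\<Sum>t\<in>{1..T}. \<Sum>i<N. l t i * of_bool (leader N (cum_loss l t) z i)))"
    unfolding inner[symmetric]
    using term_int by (intro Bochner_Integration.integral_sum[symmetric] Bochner_Integration.integrable_sum) auto
  also have "\<dots> \<le> (LINT z|?P. best_loss N l T + u + (\<Sum>j<N. max (z j - u) 0) + max (- z k) 0)"
  proof (rule integral_mono[OF lhs_int])
    show "integrable ?P (\<lambda>z. best_loss N l T + u + (\<Sum>j<N. max (z j - u) 0) + max (- z k) 0)"
      using rhs_int comp(1)[OF k(1) neg] by simp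
    fix z
    show "(\<Sum>t\<in>{1..T}. \<Sum>i<N. l t i * of_bool (leader N (cum_loss l t) z i))
        \<le> best_loss N l T + u + (\<Sum>j<N. max (z j - u) 0) + max (- z k) 0"
      using be_the_leader[OF N k(1), where l = l and T = T and z = z] Max_le_add_sum_excess[OF N, of z u] k(2)
      by linarith
  qed
  also have "\<dots> = best_loss N l T + B"
    using comp(1)[OF k(1) neg] comp(2)[OF k(1) neg] rhs_int comp(1)[OF _ u(2)] comp(2)[OF _ u(2)]
    by (simp add: Bochner_Integration.integral_sum B_def P.prob_space)
  finally have btl: "(\<Sum>t\<in>{1..T}. \<Sum>i<N. l t i * ?p t i) \<le> best_loss N l T + B" .
  have stable: "?p (t - 1) i * l t i \<le> (1 + 2 * \<epsilon>) * (l t i * ?p t i)"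
    if "t \<in> {1..T}" "i < N" for t i
  proof -
    \<comment> \<open>Natural subtraction is harmless here because rounds start at 1.\<close>
    have step: "cum_loss l t j = cum_loss l (t - 1) j + l t j" for j
      using that by (cases t) (auto simp: cum_loss_def)
    have p: "(1 - \<epsilon>) * ?p (t - 1) i \<le> ?p t i"
      using \<epsilon> l by (intro ftpl_prob_stable[OF assms(1) D that(2) _ shift]) (auto simp: step)
    \<comment> \<open>This is the excess of \<open>(1 + 2 * \<epsilon>) * (1 - \<epsilon>)\<close>
      over 1, and the place where \<open>\<epsilon> \<le> 1/2\<close> makes
      \<open>1 + 2 * \<epsilon>\<close> an upper bound for
      \<open>1 / (1 - \<epsilon>)\<close>.\<close>
    have "0 \<le> \<epsilon> * (1 - 2 * \<epsilon>)" using \<epsilon> by simp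
    then have "1 \<le> (1 + 2 * \<epsilon>) * (1 - \<epsilon>)" by (simp add: algebra_simps)
    then have "?p (t - 1) i \<le> (1 + 2 * \<epsilon>) * (1 - \<epsilon>) * ?p (t - 1) i"
      using mult_right_mono[of 1 _ "?p (t - 1) i"] by (simp add: ftpl_prob_def)
    also have "\<dots> \<le> (1 + 2 * \<epsilon>) * ?p t i"
      using mult_left_mono[OF p, of "1 + 2 * \<epsilon>"] \<epsilon> by (simp add: mult.assoc)
    finally have "?p (t - 1) i * l t i \<le> (1 + 2 * \<epsilon>) * ?p t i * l t i"
      using l(1)[of t i] by (rule mult_right_mono)
    then show ?thesis by (simp add: mult_ac)
  qed
  have "(\<Sum>t\<in>{1..T}. \<Sum>i<N. ?p (t - 1) i * l t i)
      \<le> (1 + 2 * \<epsilon>) * (\<Sum>t\<in>{1..T}. \<Sum>i<N. l t i * ?p t i)"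
    unfolding sum_distrib_left using stable by (intro sum_mono) auto
  also have "\<dots> \<le> (1 + 2 * \<epsilon>) * (best_loss N l T + B)"
    using btl \<epsilon> by (intro mult_left_mono) auto
  \<comment> \<open>The coefficient of \<open>B\<close> is
    \<open>1 + 2 * \<epsilon> \<le> 2\<close>.\<close>
  also have "\<dots> \<le> best_loss N l T + (2 * \<epsilon> * best_loss N l T + 2 * B)"
    using mult_right_mono[OF \<epsilon>(2) B] by (simp add: algebra_simps)
  finally show ?thesis unfolding ftpl_regret_def B_def[symmetric] by simp
qed

text \<open>A single expert needs its own treatment: \<open>ln 1 = 0\<close> makes the target bound
  zero, leaving no room for an additive constant.\<close>

lemma ftpl_regret_one:
  assumes "prob_space D"
  shows "ftpl_regret D 1 T l = 0"
proof -
  interpret P: prob_space "PiM {..<1::nat} (\<lambda>_. D)"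
    by (rule prob_space_PiM) (rule assms(1))
  have "ftpl_prob D 1 L 0 = 1" for L
    using P.prob_space by (simp add: ftpl_prob_def)
  then show ?thesis by (simp add: ftpl_regret_def best_loss_def cum_loss_def lessThan_Suc)
qed

section \<open>Criteria for the hazard rate and for the tail excess of a density\<close>

text \<open>Extended endpoints treat supports bounded below and the whole line alike. Limits at the
  endpoints replace values because a density may jump where its support begins.\<close>

lemma nn_integral_FTC_einterval:
  fixes f F :: "real \<Rightarrow> real" and a b :: ereal
  assumes "a < b"
    and "\<And>x. a < ereal x \<Longrightarrow> ereal x < b \<Longrightarrow> DERIV F x :> f x"
    and "\<And>x. a < ereal x \<Longrightarrow> ereal x < b \<Longrightarrow> isCont f x"
    and nonneg: "\<And>x. 0 \<le> f x"
    and "((F \<circ> real_of_ereal) \<longlongrightarrow> A) (at_right a)"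
    and "((F \<circ> real_of_ereal) \<longlongrightarrow> B) (at_left b)"
  shows "(\<integral>\<^sup>+x. ennreal (f x) * indicator (einterval a b) x \<partial>lborel) = ennreal (B - A)"
proof -
  have "AE x in lborel. a < ereal x \<longrightarrow> ereal x < b \<longrightarrow> 0 \<le> f x" using nonneg by simp
  note FTC = interval_integral_FTC_nonneg[OF assms(1,2,3) this assms(5,6)]
  have "(\<integral>\<^sup>+x. ennreal (f x) * indicator (einterval a b) x \<partial>lborel) =
      (\<integral>\<^sup>+x. ennreal (indicator (einterval a b) x *\<^sub>R f x) \<partial>lborel)"
    by (intro nn_integral_cong) (simp add: indicator_def)
  also have "\<dots> = ennreal (LINT x|lborel. indicator (einterval a b) x *\<^sub>R f x)"
    using FTC(1) nonneg by (intro nn_integral_eq_integral) (auto simp: set_integrable_def)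
  also have "(LINT x|lborel. indicator (einterval a b) x *\<^sub>R f x) = B - A"
    using FTC(2) less_imp_le[OF \<open>a < b\<close>] by (simp add: interval_lebesgue_integral_def set_lebesgue_integral_def)
  finally show ?thesis .
qed

text \<open>\<open>G\<close> is the candidate survival function on the support
  \<open>(m, \<infinity>)\<close>. Its limits 1 and 0 give total mass 1, and the fundamental theorem
  identifies \<open>G x\<close> with the mass above \<open>x\<close>.\<close>

lemma hazard_rate_leI:
  fixes f G :: "real \<Rightarrow> real" and m :: ereal
  assumes [measurable]: "f \<in> borel_measurable borel"
    and m: "m < \<infinity>" and nonneg: "\<And>x. 0 \<le> f x" and zero: "\<And>x. ereal x < m \<Longrightarrow> f x = 0"
    and deriv: "\<And>x. m < ereal x \<Longrightarrow> DERIV G x :> - f x"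
    and cont: "\<And>x. m < ereal x \<Longrightarrow> isCont f x"
    and top: "(G \<longlongrightarrow> 0) at_top" and bot: "((G \<circ> real_of_ereal) \<longlongrightarrow> 1) (at_right m)"
    and hazard: "\<And>x. m < ereal x \<Longrightarrow> f x \<le> \<epsilon> * G x" and "0 \<le> \<epsilon>"
  shows "hazard_rate_le \<epsilon> f"
proof -
  define D where "D = density lborel (\<lambda>x. ennreal (f x))"
  \<comment> \<open>Nothing is assumed about \<open>f\<close> at \<open>m\<close> itself, so this
    point is discarded as a null set.\<close>
  have m_null: "AE x in lborel. ereal x \<noteq> m"
  proof (cases m)
    case (real r)
    then show ?thesis using AE_lborel_singleton[of r] by simp
  qed auto
  have top': "(((\<lambda>x. - G x) \<circ> real_of_ereal) \<longlongrightarrow> 0) (at_left \<infinity>)"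
    using tendsto_minus[OF top] by (simp add: ereal_tendsto_simps1)
  have deriv': "DERIV (\<lambda>x. - G x) x :> f x" if "m < ereal x" for x
    using DERIV_minus[OF deriv[OF that]] by simp
  have bot': "(((\<lambda>x. - G x) \<circ> real_of_ereal) \<longlongrightarrow> - 1) (at_right m)"
    using tendsto_minus[OF bot] by (simp add: comp_def)
  have "emeasure D (space D) = (\<integral>\<^sup>+x. ennreal (f x) * indicator UNIV x \<partial>lborel)"
    unfolding D_def by (subst emeasure_density) auto
  also have "\<dots> = (\<integral>\<^sup>+x. ennreal (f x) * indicator (einterval m \<infinity>) x \<partial>lborel)"
  proof (rule nn_integral_cong_AE, use m_null in eventually_elim)
    fix x assume "ereal x \<noteq> m"
    then show "ennreal (f x) * indicator UNIV x = ennreal (f x) * indicator (einterval m \<infinity>) x"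
      using zero[of x] by (cases "ereal x < m") (auto simp: einterval_iff indicator_def)
  qed
  also have "\<dots> = ennreal (0 - (- 1))"
    by (rule nn_integral_FTC_einterval[OF m deriv' cont nonneg bot' top'])
  finally have "emeasure D (space D) = 1" by simp
  then have D: "prob_space D" by (rule prob_spaceI)
  interpret prob_space D by fact
  have tail: "G x \<le> measure D {x..}" if x: "m < ereal x" for x
  proof -
    have lim: "(((\<lambda>x. - G x) \<circ> real_of_ereal) \<longlongrightarrow> - G x) (at_right (ereal x))"
      using DERIV_isCont[OF deriv'[OF x]]
      by (auto simp: ereal_tendsto_simps1 isCont_def intro: filterlim_mono at_le)
    have "ennreal (0 - (- G x)) = (\<integral>\<^sup>+y. ennreal (f y) * indicator (einterval x \<infinity>) y \<partial>lborel)"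
      using x by (intro nn_integral_FTC_einterval[OF _ deriv' cont nonneg lim top', symmetric])
        (auto intro: less_trans)
    also have "\<dots> = emeasure D {x<..}"
      unfolding D_def by (subst emeasure_density) auto
    also have "\<dots> \<le> emeasure D {x..}"
      by (intro emeasure_mono) (auto simp: D_def)
    finally show ?thesis by (simp add: emeasure_eq_measure)
  qed
  have "AE x in lborel. f x \<le> \<epsilon> * measure D {x..}"
    using m_null
  proof eventually_elim
    fix x assume "ereal x \<noteq> m"
    then consider "ereal x < m" | "m < ereal x" by fastforce
    then show "f x \<le> \<epsilon> * measure D {x..}"
    proof cases
      case 1
      then show ?thesis using zero \<open>0 \<le> \<epsilon>\<close> by simp
    next
      case 2
      then show ?thesis
        using hazard[OF 2] mult_left_mono[OF tail[OF 2] \<open>0 \<le> \<epsilon>\<close>] by linarith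
    qed
  qed
  with D show ?thesis by (simp add: hazard_rate_le_def D_def)
qed

text \<open>Direct integration of the dominating exponential. The constant \<open>c\<close> leaves
  room for densities that are only bounded by a multiple of it, such as the reflected lower tail of
  the Gumbel law.\<close>

lemma exponential_excess:
  fixes f :: "real \<Rightarrow> real"
  assumes "0 < \<epsilon>" "0 \<le> c" and f: "\<And>x. u \<le> x \<Longrightarrow> f x \<le> c * \<epsilon> * exp (- (\<epsilon> * x))"
  shows "(\<integral>\<^sup>+x. ennreal (f x) * ennreal (max (x - u) 0) \<partial>lborel) \<le> ennreal (c * exp (- (\<epsilon> * u)) / \<epsilon>)"
proof -
  have "(\<integral>\<^sup>+x. ennreal (f x) * ennreal (max (x - u) 0) \<partial>lborel) \<le>
      (\<integral>\<^sup>+x. ennreal (c * \<epsilon> * exp (- (\<epsilon> * x)) * (x - u)) * indicator {u..} x \<partial>lborel)"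
  proof (rule nn_integral_mono)
    fix x
    show "ennreal (f x) * ennreal (max (x - u) 0) \<le>
        ennreal (c * \<epsilon> * exp (- (\<epsilon> * x)) * (x - u)) * indicator {u..} x"
    proof (cases "u \<le> x")
      case True
      then have "ennreal (f x * (x - u)) \<le> ennreal (c * \<epsilon> * exp (- (\<epsilon> * x)) * (x - u))"
        using f by (intro ennreal_leI mult_right_mono) auto
      then show ?thesis using True by (simp add: max_def ennreal_mult'')
    qed auto
  qed
  also have "\<dots> = ennreal (0 - - (c * (u - u + 1 / \<epsilon>) * exp (- (\<epsilon> * u))))"
  proof (rule nn_integral_FTC_atLeast[where F = "\<lambda>x. - (c * (x - u + 1 / \<epsilon>) * exp (- (\<epsilon> * x)))"])
    show "((\<lambda>x. - (c * (x - u + 1 / \<epsilon>) * exp (- (\<epsilon> * x)))) \<longlongrightarrow> 0) at_top"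
      using assms(1) by real_asymp
    show "((\<lambda>x. - (c * (x - u + 1 / \<epsilon>) * exp (- (\<epsilon> * x)))) has_real_derivative
        c * \<epsilon> * exp (- (\<epsilon> * x)) * (x - u)) (at x)" for x
      using assms(1) by (auto intro!: derivative_eq_intros simp: field_simps)
  qed (use assms in auto)
  finally show ?thesis by simp
qed

text \<open>Replacing \<open>x - u\<close> by \<open>x\<close> leaves a pure power, whose integral
  carries the factor \<open>a / (a - 1)\<close>; \<open>2 \<le> a\<close> bounds this by 2 uniformly
  in the shape.\<close>

lemma power_law_excess:
  fixes f :: "real \<Rightarrow> real"
  assumes "0 < u" "2 \<le> a" "0 < s" and f: "\<And>x. u \<le> x \<Longrightarrow> f x \<le> a * s powr a * x powr (- a - 1)"
  shows "(\<integral>\<^sup>+x. ennreal (f x) * ennreal (max (x - u) 0) \<partial>lborel) \<le>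
    ennreal (2 * s powr a * u powr (1 - a))"
proof -
  have "(\<integral>\<^sup>+x. ennreal (f x) * ennreal (max (x - u) 0) \<partial>lborel) \<le>
      (\<integral>\<^sup>+x. ennreal (a * s powr a * x powr (- a)) * indicator {u..} x \<partial>lborel)"
  proof (rule nn_integral_mono)
    fix x
    show "ennreal (f x) * ennreal (max (x - u) 0) \<le> ennreal (a * s powr a * x powr (- a)) * indicator {u..} x"
    proof (cases "u \<le> x")
      case True
      have "f x * (x - u) \<le> (a * s powr a * x powr (- a - 1)) * (x - u)"
        using f[OF True] True by (intro mult_right_mono) auto
      also have "\<dots> \<le> (a * s powr a * x powr (- a - 1)) * x"
        using assms True by (intro mult_left_mono) auto
      also have "\<dots> = a * s powr a * x powr (- a)"
        using assms True by (simp add: powr_diff powr_minus field_simps)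
      finally have "ennreal (f x * (x - u)) \<le> ennreal (a * s powr a * x powr (- a))"
        by (rule ennreal_leI)
      then show ?thesis using True by (simp add: max_def ennreal_mult'')
    qed auto
  qed
  also have "\<dots> = ennreal (0 - - (a / (a - 1) * s powr a * u powr (1 - a)))"
  proof (rule nn_integral_FTC_atLeast)
    show "((\<lambda>x. - (a / (a - 1) * s powr a * x powr (1 - a))) \<longlongrightarrow> 0) at_top"
      using assms by real_asymp
    show "((\<lambda>x. - (a / (a - 1) * s powr a * x powr (1 - a))) has_real_derivative
        a * s powr a * x powr (- a)) (at x)" if "u \<le> x" for x
    proof -
      have "a / (a - 1) * s powr a * ((1 - a) * x powr (1 - a - 1)) = - (a * s powr a * x powr (- a))"
        using assms by (simp add: field_simps)
      then show ?thesis
        using DERIV_minus[OF DERIV_cmult[OF has_real_derivative_powr[of x "1 - a"], of "a / (a - 1) * s powr a"]]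
          assms that by simp
    qed
  qed (use assms in auto)
  also have "\<dots> \<le> ennreal (2 * s powr a * u powr (1 - a))"
  proof (rule ennreal_leI)
    have "a / (a - 1) \<le> 2" using assms by (simp add: field_simps)
    then have "a / (a - 1) * (s powr a * u powr (1 - a)) \<le> 2 * (s powr a * u powr (1 - a))"
      by (rule mult_right_mono) simp
    then show "0 - - (a / (a - 1) * s powr a * u powr (1 - a)) \<le> 2 * s powr a * u powr (1 - a)"
      by (simp add: mult.assoc)
  qed
  finally show ?thesis .
qed

section \<open>Tuning the rate and the common reduction for all families\<close>

text \<open>Above the threshold \<open>L = 4 * n\<close>, where \<open>sqrt (n / L)\<close> equals
  1/2, both \<open>\<epsilon> * L\<close> and \<open>n / \<epsilon>\<close> equal
  \<open>sqrt (L * n)\<close>. Below it, \<open>L / 2 \<le> sqrt (L * n)\<close> and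
  \<open>n / \<epsilon> = 2 * n\<close>. The case distinction replaces a minimum, which would give
  rate 0 at \<open>L = 0\<close> because \<open>n / 0 = 0\<close>.\<close>

lemma tuned_rate_bound:
  fixes L n K :: real
  assumes "0 \<le> L" "0 < n" "0 \<le> K"
  defines "\<epsilon> \<equiv> if 4 * n < L then sqrt (n / L) else 1 / 2"
  shows "0 < \<epsilon>" "\<epsilon> \<le> 1 / 2"
    and "2 * \<epsilon> * L + 2 * (K * n / \<epsilon>) \<le> (2 + 4 * K) * (sqrt (L * n) + n)"
proof -
  show "0 < \<epsilon>" using assms by (auto simp: \<epsilon>_def)
  have "sqrt (n / L) \<le> sqrt (1 / 4)" if "4 * n < L"
    using that assms by (intro real_sqrt_le_mono) (auto simp: field_simps)
  then show "\<epsilon> \<le> 1 / 2" by (auto simp: \<epsilon>_def real_sqrt_divide)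
  have "\<epsilon> * L \<le> sqrt (L * n) \<and> n / \<epsilon> \<le> 2 * n + sqrt (L * n)"
  proof (cases "4 * n < L")
    case True
    then have L: "0 < L" using assms by simp
    have "sqrt (n / L) * L = sqrt (L * n)" "n / sqrt (n / L) = sqrt (L * n)"
      using real_sqrt_mult_self[of L] real_sqrt_mult_self[of n] L \<open>0 < n\<close>
      by (auto simp: real_sqrt_divide real_sqrt_mult field_simps simp del: real_sqrt_mult_self)
    then show ?thesis using True assms by (simp add: \<epsilon>_def)
  next
    case False
    have "L / 2 = sqrt (L * (L / 4))"
      using assms by (simp add: real_sqrt_mult real_sqrt_divide)
    also have "\<dots> \<le> sqrt (L * n)"
      using False assms by (intro real_sqrt_le_mono mult_left_mono) auto
    finally show ?thesis using False assms by (simp add: \<epsilon>_def)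
  qed
  then have e: "\<epsilon> * L \<le> sqrt (L * n)" "n / \<epsilon> \<le> 2 * n + sqrt (L * n)" by auto
  have "2 * \<epsilon> * L + 2 * (K * n / \<epsilon>) = 2 * (\<epsilon> * L) + 2 * K * (n / \<epsilon>)" by simp
  also have "\<dots> \<le> 2 * sqrt (L * n) + 2 * K * (2 * n + sqrt (L * n))"
    using e \<open>0 \<le> K\<close> by (intro add_mono mult_left_mono) auto
  also have "\<dots> \<le> (2 + 4 * K) * (sqrt (L * n) + n)"
    using assms by (simp add: algebra_simps)
  finally show "2 * \<epsilon> * L + 2 * (K * n / \<epsilon>) \<le> (2 + 4 * K) * (sqrt (L * n) + n)" .
qed

lemma density_integral_le:
  fixes f g :: "real \<Rightarrow> real"
  assumes [measurable]: "f \<in> borel_measurable borel" "g \<in> borel_measurable borel"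
    and "\<And>x. 0 \<le> g x" "0 \<le> v"
    and bound: "(\<integral>\<^sup>+x. ennreal (f x) * ennreal (g x) \<partial>lborel) \<le> ennreal v"
  shows "integrable (density lborel (\<lambda>x. ennreal (f x))) g"
    "(LINT x|density lborel (\<lambda>x. ennreal (f x)). g x) \<le> v"
proof -
  have nn: "(\<integral>\<^sup>+x. ennreal (g x) \<partial>density lborel (\<lambda>x. ennreal (f x))) \<le> ennreal v"
    using bound by (simp add: nn_integral_density)
  then show int: "integrable (density lborel (\<lambda>x. ennreal (f x))) g"
    using assms by (intro integrableI_nonneg) (auto intro: le_less_trans)
  show "(LINT x|density lborel (\<lambda>x. ennreal (f x)). g x) \<le> v"
    using nn assms nn_integral_eq_integral[OF int] by simp
qed

text \<open>Interface for the five families: for each rate a member with that hazard rate and an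
  excess of order \<open>ln N / \<epsilon>\<close>. The choice of rate, the shift argument and the
  regret bound are dealt with once, here.\<close>

lemma ftpl_achieves_boundI:
  fixes par :: "nat \<Rightarrow> real \<Rightarrow> 'p" and pdf :: "'p \<Rightarrow> real \<Rightarrow> real"
  assumes valid: "\<And>N \<epsilon>. 0 < \<epsilon> \<Longrightarrow> valid (par N \<epsilon>)"
    and hazard: "\<And>N \<epsilon>. N \<ge> 1 \<Longrightarrow> 0 < \<epsilon> \<Longrightarrow> hazard_rate_le \<epsilon> (pdf (par N \<epsilon>))"
    and excess: "\<And>N \<epsilon>. N \<ge> 2 \<Longrightarrow> 0 < \<epsilon> \<Longrightarrow> \<exists>u v w. 0 \<le> u \<and> 0 \<le> v \<and> 0 \<le> w \<and>
      (\<integral>\<^sup>+x. ennreal (pdf (par N \<epsilon>) x) * ennreal (max (x - u) 0) \<partial>lborel) \<le> ennreal v \<and>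
      (\<integral>\<^sup>+x. ennreal (pdf (par N \<epsilon>) x) * ennreal (max (- x) 0) \<partial>lborel) \<le> ennreal w \<and>
      u + real N * v + w \<le> K * ln (real N) / \<epsilon>"
    and K: "0 \<le> K"
  shows "ftpl_achieves_bound pdf valid"
proof -
  \<comment> \<open>Validity of the parameters is demanded for all \<open>N\<close> and all real
    \<open>L\<close>, so the rate must be positive everywhere. Without the guard
    \<open>N \<ge> 2\<close> it would vanish for \<open>N = 1\<close> and
    \<open>L > 0\<close>.\<close>
  define rate where "rate N L = (if N \<ge> 2 \<and> 4 * ln (real N) < L then sqrt (ln (real N) / L) else 1 / 2)"
    for N :: nat and L :: real
  have rate: "0 < rate N L" for N L
    by (auto simp: rate_def intro!: divide_pos_pos le_less_trans[of 0 "4 * ln (real N)" L])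
  show ?thesis
    unfolding ftpl_achieves_bound_def
  proof (intro exI[of _ "2 + 4 * K"] exI[of _ "\<lambda>N L. par N (rate N L)"] conjI allI impI)
    show "valid (par N (rate N L))" for N L using valid rate .
    fix N T :: nat and l :: "nat \<Rightarrow> nat \<Rightarrow> real"
    assume N: "1 \<le> N" and l: "\<forall>t i. 0 \<le> l t i \<and> l t i \<le> 1"
    define L where "L = best_loss N l T"
    have meas: "pdf (par N (rate N L)) \<in> borel_measurable borel"
      using hazard[OF N rate] by (simp add: hazard_rate_le_def)
    define D where "D = density lborel (\<lambda>x. ennreal (pdf (par N (rate N L)) x))"
    have D: "prob_space D" "sets D = sets borel"
      unfolding D_def using hazard[OF N rate] by (auto simp: hazard_rate_le_def)
    have "ftpl_regret D N T l \<le> (2 + 4 * K) * (sqrt (L * ln (real N)) + ln (real N))"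
    proof (cases "N = 1")
      case True
      then show ?thesis using ftpl_regret_one[OF D(1)] by simp
    next
      case False
      with N have N2: "N \<ge> 2" by simp
      have L0: "0 \<le> L"
        using N l by (auto simp: L_def best_loss_def cum_loss_def lessThan_empty_iff intro!: sum_nonneg)
      have rate_eq: "rate N L = (if 4 * ln (real N) < L then sqrt (ln (real N) / L) else 1 / 2)"
        using N2 by (simp add: rate_def)
      have ln0: "0 < ln (real N)" using N2 by simp
      note tune = tuned_rate_bound[OF L0 ln0 K, folded rate_eq]
      obtain u v w where uvw: "0 \<le> u" "0 \<le> v" "0 \<le> w"
        "(\<integral>\<^sup>+x. ennreal (pdf (par N (rate N L)) x) * ennreal (max (x - u) 0) \<partial>lborel) \<le> ennreal v"
        "(\<integral>\<^sup>+x. ennreal (pdf (par N (rate N L)) x) * ennreal (max (- x) 0) \<partial>lborel) \<le> ennreal w"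
        "u + real N * v + w \<le> K * ln (real N) / rate N L"
        using excess[OF N2 rate[of N L]] by blast
      have pos: "integrable D (\<lambda>z. max (z - u) 0)" "(LINT z|D. max (z - u) 0) \<le> v"
        using density_integral_le[OF meas _ _ uvw(2,4)] by (auto simp: D_def)
      have neg: "integrable D (\<lambda>z. max (- z) 0)" "(LINT z|D. max (- z) 0) \<le> w"
        using density_integral_le[OF meas _ _ uvw(3,5)] by (auto simp: D_def)
      have shift: "(1 - rate N L) * measure D S \<le> measure D {x. x - 1 \<in> S}"
        if "S \<in> sets borel" "\<And>x y. x \<in> S \<Longrightarrow> x \<le> y \<Longrightarrow> y \<in> S" for S
        unfolding D_def
        using tune(1) by (intro hazard_rate_le_shift[OF hazard[OF N] that(1) _ that(2)]) auto
      have "ftpl_regret D N T l \<le> 2 * rate N L * L +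
          2 * (u + real N * (LINT z|D. max (z - u) 0) + (LINT z|D. max (- z) 0))"
        unfolding L_def
        by (rule ftpl_regret_le[OF D N _ _ shift[unfolded L_def] _ _ uvw(1) pos(1) neg(1)])
          (use tune(1,2) l in \<open>auto simp: L_def\<close>)
      also have "\<dots> \<le> 2 * rate N L * L + 2 * (K * ln (real N) / rate N L)"
        using uvw(6) neg(2) mult_left_mono[OF pos(2), of "real N"] by simp
      also have "\<dots> \<le> (2 + 4 * K) * (sqrt (L * ln (real N)) + ln (real N))"
        by (rule tune(3))
      finally show ?thesis .
    qed
    then show "ftpl_regret (density lborel (\<lambda>x. ennreal (pdf (par N (rate N (best_loss N l T))) x))) N T l
        \<le> (2 + 4 * K) * (sqrt (best_loss N l T * ln (real N)) + ln (real N))"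
      by (simp add: D_def L_def)
  qed
qed

section \<open>The individual perturbation families\<close>

text \<open>Absorbs additive constants into multiples of \<open>ln N\<close>; this is where the
  constants 3, 7 and 90 below get their slack.\<close>

lemma half_le_ln:
  assumes "(N::nat) \<ge> 2"
  shows "1 / 2 \<le> ln (real N)"
proof -
  have "1 / 2 \<le> ln (2::real)" using ln_ge_iff[of 2 "1/2"] exp_half_le2 by simp
  also have "\<dots> \<le> ln (real N)" using assms by simp
  finally show ?thesis .
qed

lemma nonneg_support_negative_part:
  assumes "\<And>x. x < 0 \<Longrightarrow> f x = (0::real)"
  shows "(\<integral>\<^sup>+x. ennreal (f x) * ennreal (max (- x) 0) \<partial>lborel) \<le> ennreal 0"
proof -
  have "ennreal (f x) * ennreal (max (- x) 0) = 0" for x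
    using assms[of x] by (cases "x < 0") auto
  then show ?thesis by (simp only:) simp
qed

lemma isCont_if_greater:
  fixes g :: "real \<Rightarrow> real"
  assumes "isCont g x" "m < x"
  shows "isCont (\<lambda>x. if m < x then g x else c) x"
proof -
  have "\<forall>\<^sub>F y in nhds x. (if m < y then g y else c) = g y"
    using eventually_nhds_in_open[of "{m<..}" x] assms(2) by (auto elim: eventually_mono)
  then show ?thesis using assms(1) by (simp only: isCont_cong)
qed

text \<open>Stated for an abstract density so that Gamma and Weibull of shape 1 share it. The hazard
  rate of the exponential law is exactly \<open>\<epsilon>\<close>.\<close>

lemma exponential_achieves_bound:
  fixes par :: "nat \<Rightarrow> real \<Rightarrow> 'p"
  assumes valid: "\<And>N \<epsilon>. 0 < \<epsilon> \<Longrightarrow> valid (par N \<epsilon>)"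
    and pdf: "\<And>N \<epsilon>. 0 < \<epsilon> \<Longrightarrow> pdf (par N \<epsilon>) = (\<lambda>x. if 0 < x then \<epsilon> * exp (- (\<epsilon> * x)) else 0)"
  shows "ftpl_achieves_bound pdf valid"
proof (rule ftpl_achieves_boundI[where par = par and K = 3])
  fix N :: nat and \<epsilon> :: real assume \<epsilon>: "0 < \<epsilon>"
  show "valid (par N \<epsilon>)" using valid \<epsilon> .
  show "hazard_rate_le \<epsilon> (pdf (par N \<epsilon>))"
    unfolding pdf[OF \<epsilon>]
  proof (rule hazard_rate_leI[where m = "ereal 0" and G = "\<lambda>x. exp (- (\<epsilon> * x))"])
    show "((\<lambda>x. exp (- (\<epsilon> * x))) \<longlongrightarrow> 0) at_top" using \<epsilon> by real_asymp
    have "((\<lambda>x. exp (- (\<epsilon> * x))) \<longlongrightarrow> 1) (at_right 0)" using \<epsilon> by real_asymp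
    then show "(((\<lambda>x. exp (- (\<epsilon> * x))) \<circ> real_of_ereal) \<longlongrightarrow> 1) (at_right (ereal 0))"
      by (simp only: ereal_tendsto_simps1)
    show "isCont (\<lambda>x. if 0 < x then \<epsilon> * exp (- (\<epsilon> * x)) else 0) x" if "ereal 0 < ereal x" for x
      using that by (intro isCont_if_greater continuous_intros) auto
  qed (use \<epsilon> in \<open>auto intro!: derivative_eq_intros\<close>)
next
  fix N :: nat and \<epsilon> :: real assume N: "2 \<le> N" and \<epsilon>: "0 < \<epsilon>"
  \<comment> \<open>The threshold with tail probability \<open>1 / N\<close>; the \<open>N\<close>
    excesses then contribute \<open>1 / \<epsilon>\<close> in total.\<close>
  let ?u = "ln (real N) / \<epsilon>"
  have u: "0 \<le> ?u" using N \<epsilon> by simp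
  have "exp (- (\<epsilon> * ?u)) / \<epsilon> = 1 / (N * \<epsilon>)"
    using N \<epsilon> by (simp add: exp_minus field_simps)
  then have "(\<integral>\<^sup>+x. ennreal (pdf (par N \<epsilon>) x) * ennreal (max (x - ?u) 0) \<partial>lborel) \<le> ennreal (1 / (N * \<epsilon>))"
    using exponential_excess[OF \<epsilon>, of 1 ?u "pdf (par N \<epsilon>)"] \<epsilon> by (simp add: pdf)
  moreover have "?u + real N * (1 / (N * \<epsilon>)) + 0 \<le> 3 * ln (real N) / \<epsilon>"
    using half_le_ln[OF N] N \<epsilon> by (simp add: field_simps)
  ultimately show "\<exists>u v w. 0 \<le> u \<and> 0 \<le> v \<and> 0 \<le> w \<and>
      (\<integral>\<^sup>+x. ennreal (pdf (par N \<epsilon>) x) * ennreal (max (x - u) 0) \<partial>lborel) \<le> ennreal v \<and>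
      (\<integral>\<^sup>+x. ennreal (pdf (par N \<epsilon>) x) * ennreal (max (- x) 0) \<partial>lborel) \<le> ennreal w \<and>
      u + real N * v + w \<le> 3 * ln (real N) / \<epsilon>"
    using u \<epsilon> nonneg_support_negative_part[of "pdf (par N \<epsilon>)"]
    by (intro exI[of _ ?u] exI[of _ "1 / (N * \<epsilon>)"] exI[of _ 0]) (auto simp: pdf)
qed simp

lemma gamma_achieves_bound: "ftpl_achieves_bound gamma_pdf gamma_valid"
  by (rule exponential_achieves_bound[where par = "\<lambda>N \<epsilon>. (1, 1 / \<epsilon>)"])
    (auto simp: gamma_valid_def gamma_pdf_def fun_eq_iff mult.commute)

lemma weibull_achieves_bound: "ftpl_achieves_bound weibull_pdf weibull_valid"
  by (rule exponential_achieves_bound[where par = "\<lambda>N \<epsilon>. (1, 1 / \<epsilon>)"])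
    (auto simp: weibull_valid_def weibull_pdf_def fun_eq_iff mult.commute)

text \<open>The only family with mass on the negative axis, hence the extra bound
  \<open>2 / \<epsilon>\<close> for the negative part. The total \<open>ln N + 1 + 2\<close> is at
  most \<open>7 * ln N\<close>.\<close>

lemma gumbel_achieves_bound: "ftpl_achieves_bound gumbel_pdf gumbel_valid"
proof (rule ftpl_achieves_boundI[where par = "\<lambda>N \<epsilon>. (0, 1 / \<epsilon>)" and K = 7])
  have pdf: "gumbel_pdf (0, 1 / \<epsilon>) = (\<lambda>x. \<epsilon> * exp (- (\<epsilon> * x)) * exp (- exp (- (\<epsilon> * x))))"
    if "0 < \<epsilon>" for \<epsilon> :: real
    using that by (auto simp: gumbel_pdf_def fun_eq_iff exp_add[symmetric] field_simps)
  {
    fix N :: nat and \<epsilon> :: real assume \<epsilon>: "0 < \<epsilon>"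
    show "gumbel_valid (0, 1 / \<epsilon>)" using \<epsilon> by (simp add: gumbel_valid_def)
    show "hazard_rate_le \<epsilon> (gumbel_pdf (0, 1 / \<epsilon>))"
      unfolding pdf[OF \<epsilon>]
    proof (rule hazard_rate_leI[where m = "-\<infinity>" and G = "\<lambda>x. 1 - exp (- exp (- (\<epsilon> * x)))"])
      show "((\<lambda>x. 1 - exp (- exp (- (\<epsilon> * x)))) \<longlongrightarrow> 0) at_top" using \<epsilon> by real_asymp
      have "((\<lambda>x. 1 - exp (- exp (- (\<epsilon> * x)))) \<longlongrightarrow> 1) at_bot" using \<epsilon> by real_asymp
      then show "(((\<lambda>x. 1 - exp (- exp (- (\<epsilon> * x)))) \<circ> real_of_ereal) \<longlongrightarrow> 1) (at_right (-\<infinity>))"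
        by (simp only: ereal_tendsto_simps1)
      show "\<epsilon> * exp (- (\<epsilon> * x)) * exp (- exp (- (\<epsilon> * x))) \<le> \<epsilon> * (1 - exp (- exp (- (\<epsilon> * x))))" for x
      proof -
        \<comment> \<open>In terms of \<open>w\<close> the claim is
          \<open>w * exp (- w) \<le> 1 - exp (- w)\<close>, which is
          \<open>1 + w \<le> exp w\<close> multiplied by \<open>exp (- w)\<close>.\<close>
        define w where "w = exp (- (\<epsilon> * x))"
        have "w * exp (- w) \<le> 1 - exp (- w)"
          using exp_ge_add_one_self[of w] by (simp add: exp_minus field_simps)
        then show ?thesis
          unfolding w_def[symmetric] mult.assoc using \<epsilon> by (intro mult_left_mono) auto
      qed
    qed (use \<epsilon> in \<open>auto intro!: derivative_eq_intros continuous_intros\<close>)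
  }
  fix N :: nat and \<epsilon> :: real assume N: "2 \<le> N" and \<epsilon>: "0 < \<epsilon>"
  let ?f = "gumbel_pdf (0, 1 / \<epsilon>)"
  let ?u = "ln (real N) / \<epsilon>"
  have u: "0 \<le> ?u" using N \<epsilon> by simp
  have "exp (- (\<epsilon> * ?u)) / \<epsilon> = 1 / (N * \<epsilon>)"
    using N \<epsilon> by (simp add: exp_minus field_simps)
  then have pos: "(\<integral>\<^sup>+x. ennreal (?f x) * ennreal (max (x - ?u) 0) \<partial>lborel) \<le> ennreal (1 / (N * \<epsilon>))"
    using exponential_excess[OF \<epsilon>, of 1 ?u ?f] \<epsilon> by (simp add: pdf)
  \<comment> \<open>The lower tail decays doubly exponentially; the quadratic Taylor bound for
    \<open>exp\<close> already yields enough decay to reuse \<open>exponential_excess\<close> after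
    reflection.\<close>
  have "?f (- x) \<le> 2 * \<epsilon> * exp (- (\<epsilon> * x))" if "0 \<le> x" for x
  proof -
    define w where "w = exp (\<epsilon> * x)"
    have w: "0 < w" by (simp add: w_def)
    have "w * w \<le> 2 * exp w"
      using exp_lower_Taylor_quadratic[of w] w by (simp add: power2_eq_square)
    then have "w * exp (- w) \<le> 2 / w"
      using w by (simp add: exp_minus field_simps)
    then have "\<epsilon> * (w * exp (- w)) \<le> \<epsilon> * (2 / w)"
      using \<epsilon> by (intro mult_left_mono) auto
    then show ?thesis
      unfolding pdf[OF \<epsilon>] by (simp add: w_def exp_minus field_simps)
  qed
  then have "(\<integral>\<^sup>+x. ennreal (?f (- x)) * ennreal (max (x - 0) 0) \<partial>lborel) \<le> ennreal (2 * exp (- (\<epsilon> * 0)) / \<epsilon>)"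
    by (intro exponential_excess \<epsilon>) auto
  moreover have "(\<integral>\<^sup>+x. ennreal (?f x) * ennreal (max (- x) 0) \<partial>lborel) =
      (\<integral>\<^sup>+x. ennreal (?f (- x)) * ennreal (max (x - 0) 0) \<partial>lborel)"
    unfolding pdf[OF \<epsilon>] by (subst nn_integral_real_affine[where c = "-1" and t = 0]) auto
  ultimately have neg: "(\<integral>\<^sup>+x. ennreal (?f x) * ennreal (max (- x) 0) \<partial>lborel) \<le> ennreal (2 / \<epsilon>)"
    by simp
  have "?u + real N * (1 / (N * \<epsilon>)) + 2 / \<epsilon> \<le> 7 * ln (real N) / \<epsilon>"
    using half_le_ln[OF N] N \<epsilon> by (simp add: field_simps)
  then show "\<exists>u v w. 0 \<le> u \<and> 0 \<le> v \<and> 0 \<le> w \<and>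
      (\<integral>\<^sup>+x. ennreal (?f x) * ennreal (max (x - u) 0) \<partial>lborel) \<le> ennreal v \<and>
      (\<integral>\<^sup>+x. ennreal (?f x) * ennreal (max (- x) 0) \<partial>lborel) \<le> ennreal w \<and>
      u + real N * v + w \<le> 7 * ln (real N) / \<epsilon>"
    using u \<epsilon> pos neg
    by (intro exI[of _ ?u] exI[of _ "1 / (N * \<epsilon>)"] exI[of _ "2 / \<epsilon>"]) auto
qed simp

text \<open>A shape of at least \<open>ln N\<close> keeps \<open>N powr (1 / a)\<close> below 3, so
  the threshold is of the same order as the scale. The \<open>N\<close> excesses add
  \<open>2 * u\<close>, and \<open>3 * u \<le> 18 * a / \<epsilon>\<close> with
  \<open>a \<le> 5 * ln N\<close> gives the constant 90.\<close>

lemma power_law_excess_tuned: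
  fixes f :: "real \<Rightarrow> real" and N :: nat
  defines "a \<equiv> 2 + ln (real N)"
  assumes N: "2 \<le> N" and \<epsilon>: "0 < \<epsilon>" and s: "0 < s" "s \<le> 2 * a / \<epsilon>"
    and zero: "\<And>x. x < 0 \<Longrightarrow> f x = 0"
    and f: "\<And>x. s \<le> x \<Longrightarrow> f x \<le> a * s powr a * x powr (- a - 1)"
  shows "\<exists>u v w. 0 \<le> u \<and> 0 \<le> v \<and> 0 \<le> w \<and>
      (\<integral>\<^sup>+x. ennreal (f x) * ennreal (max (x - u) 0) \<partial>lborel) \<le> ennreal v \<and>
      (\<integral>\<^sup>+x. ennreal (f x) * ennreal (max (- x) 0) \<partial>lborel) \<le> ennreal w \<and>
      u + real N * v + w \<le> 90 * ln (real N) / \<epsilon>"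
proof -
  have a: "2 \<le> a" using N by (simp add: a_def)
  \<comment> \<open>Chosen so that the power tail \<open>(s / u) powr a\<close> equals
    \<open>1 / N\<close>.\<close>
  define u where "u = s * N powr (1 / a)"
  have u0: "0 < u" using s N by (simp add: u_def)
  have su: "s \<le> u"
    using s N a ge_one_powr_ge_zero[of "real N" "1 / a"] by (simp add: u_def)
  have "ln (real N) / a \<le> 1" using a by (simp add: a_def)
  then have "N powr (1 / a) \<le> exp 1" using N by (simp add: powr_def)
  then have "N powr (1 / a) \<le> 3" using exp_le by linarith
  then have "u \<le> (2 * a / \<epsilon>) * 3"
    unfolding u_def using s a \<epsilon> by (intro mult_mono) auto
  moreover have "a \<le> 5 * ln (real N)" using half_le_ln[OF N] by (simp add: a_def)
  ultimately have u: "3 * u \<le> 90 * ln (real N) / \<epsilon>"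
    using \<epsilon> by (simp add: field_simps)
  have "s powr a * u powr (1 - a) = u * (s powr a / u powr a)"
    using u0 by (simp add: powr_diff)
  also have "u powr a = s powr a * N"
    using s N a by (simp add: u_def powr_mult powr_powr)
  finally have v: "2 * s powr a * u powr (1 - a) = 2 * u / N"
    using s N by simp
  have "(\<integral>\<^sup>+x. ennreal (f x) * ennreal (max (x - u) 0) \<partial>lborel) \<le> ennreal (2 * u / N)"
    using power_law_excess[OF u0 a s(1), of f] f su unfolding v by force
  then show ?thesis
    using u u0 N nonneg_support_negative_part[of f, OF zero]
    by (intro exI[of _ u] exI[of _ "2 * u / N"] exI[of _ 0]) auto
qed

text \<open>The hazard rate \<open>a / x\<close> decreases on the support, so its largest value is
  \<open>a / s\<close>, and the scale \<open>s = a / \<epsilon>\<close> makes this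
  \<open>\<epsilon>\<close>.\<close>

lemma pareto_achieves_bound: "ftpl_achieves_bound pareto_pdf pareto_valid"
proof (rule ftpl_achieves_boundI[where K = 90
      and par = "\<lambda>N \<epsilon>. (2 + ln (real N), (2 + ln (real N)) / \<epsilon>)"])
  fix N :: nat and \<epsilon> :: real assume \<epsilon>: "0 < \<epsilon>"
  define a where "a = 2 + ln (real N)"
  define s where "s = a / \<epsilon>"
  \<comment> \<open>Validity is also required for \<open>N = 0\<close>, where
    \<open>ln 0 = 0\<close> gives \<open>a = 2\<close>.\<close>
  have a: "2 \<le> a" by (cases "N = 0") (auto simp: a_def)
  have s: "0 < s" using a \<epsilon> by (simp add: s_def)
  show "pareto_valid (2 + ln (real N), (2 + ln (real N)) / \<epsilon>)"
    using a s by (simp add: pareto_valid_def a_def[symmetric] s_def[symmetric])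
  have pdf: "pareto_pdf (a, s) = (\<lambda>x. if s \<le> x then a * s powr a * x powr (- a - 1) else 0)"
    using s by (auto simp: pareto_pdf_def fun_eq_iff powr_diff powr_minus powr_add field_simps)
  have "hazard_rate_le \<epsilon> (pareto_pdf (a, s))"
    unfolding pdf
  proof (rule hazard_rate_leI[where m = "ereal s" and G = "\<lambda>x. s powr a * x powr (- a)"])
    show "((\<lambda>x. s powr a * x powr (- a)) \<longlongrightarrow> 0) at_top" using a by real_asymp
    have "isCont (\<lambda>x. s powr a * x powr (- a)) s"
      using s by (intro continuous_intros) auto
    then have "((\<lambda>x. s powr a * x powr (- a)) \<longlongrightarrow> s powr a * s powr (- a)) (at_right s)"
      by (auto simp: isCont_def intro: filterlim_mono at_le)
    moreover have "s powr a * s powr (- a) = 1" using s by (simp add: powr_minus)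
    ultimately show "(((\<lambda>x. s powr a * x powr (- a)) \<circ> real_of_ereal) \<longlongrightarrow> 1) (at_right (ereal s))"
      by (simp only: ereal_tendsto_simps1)
    fix x assume "ereal s < ereal x"
    then have x: "s < x" by simp
    have "isCont (\<lambda>x. if s < x then a * s powr a * x powr (- a - 1) else 0) x"
      using x s by (intro isCont_if_greater continuous_intros) auto
    \<comment> \<open>The Pareto density includes its left endpoint, whereas
      \<open>isCont_if_greater\<close> speaks of strict inequality; near \<open>x > s\<close> the
      two versions agree.\<close>
    moreover have "\<forall>\<^sub>F y in nhds x. (if s < y then a * s powr a * y powr (- a - 1) else 0) =
        (if s \<le> y then a * s powr a * y powr (- a - 1) else 0)"
      using eventually_nhds_in_open[of "{s<..}" x] x by (auto elim: eventually_mono)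
    ultimately show "isCont (\<lambda>x. if s \<le> x then a * s powr a * x powr (- a - 1) else 0) x"
      by (simp add: isCont_cong)
    show "((\<lambda>x. s powr a * x powr (- a)) has_real_derivative
        - (if s \<le> x then a * s powr a * x powr (- a - 1) else 0)) (at x)"
      using DERIV_cmult[OF has_real_derivative_powr[of x "- a"], of "s powr a"] x s by (simp add: mult_ac)
    have "a \<le> \<epsilon> * x" using x \<epsilon> by (simp add: s_def field_simps)
    then have "a * (s powr a * x powr (- a - 1)) \<le> \<epsilon> * x * (s powr a * x powr (- a - 1))"
      by (rule mult_right_mono) simp
    then show "(if s \<le> x then a * s powr a * x powr (- a - 1) else 0) \<le> \<epsilon> * (s powr a * x powr (- a))"
      using x s by (simp add: powr_diff mult_ac)
  qed (use \<epsilon> a in auto)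
  then show "hazard_rate_le \<epsilon> (pareto_pdf (2 + ln (real N), (2 + ln (real N)) / \<epsilon>))"
    by (simp add: a_def s_def)
  assume N: "2 \<le> N"
  show "\<exists>u v w. 0 \<le> u \<and> 0 \<le> v \<and> 0 \<le> w \<and>
      (\<integral>\<^sup>+x. ennreal (pareto_pdf (2 + ln (real N), (2 + ln (real N)) / \<epsilon>) x) * ennreal (max (x - u) 0) \<partial>lborel) \<le> ennreal v \<and>
      (\<integral>\<^sup>+x. ennreal (pareto_pdf (2 + ln (real N), (2 + ln (real N)) / \<epsilon>) x) * ennreal (max (- x) 0) \<partial>lborel) \<le> ennreal w \<and>
      u + real N * v + w \<le> 90 * ln (real N) / \<epsilon>"
    unfolding a_def[symmetric] s_def[symmetric]
  proof (rule power_law_excess_tuned[OF N \<epsilon>, where s = s, folded a_def])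
    show "s \<le> 2 * a / \<epsilon>" using a \<epsilon> by (simp add: s_def field_simps)
  qed (use s in \<open>auto simp: pdf\<close>)
qed simp

text \<open>With \<open>y = x / s\<close> and \<open>w = y powr (- a)\<close> the hazard rate is
  \<open>a / s\<close> times \<open>(w / y) / (exp w - 1)\<close>. The last quotient is at most 2,
  which explains the scale \<open>2 * a / \<epsilon>\<close>, twice that of Pareto.\<close>

lemma frechet_achieves_bound: "ftpl_achieves_bound frechet_pdf frechet_valid"
proof (rule ftpl_achieves_boundI[where K = 90
      and par = "\<lambda>N \<epsilon>. (2 + ln (real N), 2 * (2 + ln (real N)) / \<epsilon>, 0)"])
  fix N :: nat and \<epsilon> :: real assume \<epsilon>: "0 < \<epsilon>"
  define a where "a = 2 + ln (real N)"
  define s where "s = 2 * a / \<epsilon>"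
  have a: "2 \<le> a" by (cases "N = 0") (auto simp: a_def)
  have s: "0 < s" using a \<epsilon> by (simp add: s_def)
  show "frechet_valid (2 + ln (real N), 2 * (2 + ln (real N)) / \<epsilon>, 0)"
    using a s by (simp add: frechet_valid_def a_def[symmetric] s_def[symmetric])
  have pdf: "frechet_pdf (a, s, 0) =
      (\<lambda>x. if 0 < x then a / s * (x / s) powr (- 1 - a) * exp (- ((x / s) powr (- a))) else 0)"
    by (auto simp: frechet_pdf_def fun_eq_iff)
  have "hazard_rate_le \<epsilon> (frechet_pdf (a, s, 0))"
    unfolding pdf
  proof (rule hazard_rate_leI[where m = "ereal 0" and G = "\<lambda>x. 1 - exp (- ((x / s) powr (- a)))"])
    show "((\<lambda>x. 1 - exp (- ((x / s) powr (- a)))) \<longlongrightarrow> 0) at_top" using a s by real_asymp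
    have "((\<lambda>x. 1 - exp (- ((x / s) powr (- a)))) \<longlongrightarrow> 1) (at_right 0)" using a s by real_asymp
    then show "(((\<lambda>x. 1 - exp (- ((x / s) powr (- a)))) \<circ> real_of_ereal) \<longlongrightarrow> 1) (at_right (ereal 0))"
      by (simp only: ereal_tendsto_simps1)
    fix x assume "ereal 0 < ereal x"
    then have x: "0 < x" by simp
    show "isCont (\<lambda>x. if 0 < x then a / s * (x / s) powr (- 1 - a) * exp (- ((x / s) powr (- a))) else 0) x"
      using x s by (intro isCont_if_greater continuous_intros) auto
    have "((\<lambda>x. x / s) has_real_derivative 1 / s) (at x)"
      using s by (auto intro!: derivative_eq_intros)
    then have "((\<lambda>x. (x / s) powr (- a)) has_real_derivative (- a * (x / s) powr (- a - 1)) * (1 / s)) (at x)"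
      using x s by (intro DERIV_chain2[OF has_real_derivative_powr]) auto
    note DERIV_diff[OF DERIV_const[of 1] DERIV_fun_exp[OF DERIV_minus[OF this]]]
    then show "((\<lambda>x. 1 - exp (- ((x / s) powr (- a)))) has_real_derivative
        - (if 0 < x then a / s * (x / s) powr (- 1 - a) * exp (- ((x / s) powr (- a))) else 0)) (at x)"
      using x by (simp add: mult_ac minus_diff_commute)
    define y where "y = x / s"
    define w where "w = y powr (- a)"
    have y: "0 < y" using x s by (simp add: y_def)
    have w: "0 < w" using y by (simp add: w_def)
    \<comment> \<open>For \<open>y \<ge> 1\<close> the linear bound on \<open>exp w\<close>
      suffices. For \<open>y < 1\<close>, \<open>a \<ge> 1\<close> gives
      \<open>1 / y \<le> w\<close>, and \<open>w * w\<close> is controlled by the quadratic Taylor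
      bound, the source of the factor 2.\<close>
    have "w / y \<le> 2 * (exp w - 1)"
    proof (cases "1 \<le> y")
      case True
      then have "w / y \<le> w" using w by (simp add: field_simps)
      also have "w \<le> 2 * (exp w - 1)" using exp_ge_add_one_self[of w] w by argo
      finally show ?thesis .
    next
      case False
      then have "y powr (- 1) \<le> w"
        unfolding w_def using y a by (intro powr_mono') auto
      then have "w / y \<le> w * w"
        using y w by (simp add: powr_minus divide_inverse)
      then show ?thesis
        using exp_lower_Taylor_quadratic[of w] w by (simp add: power2_eq_square)
    qed
    then have "w / y * exp (- w) \<le> 2 * (exp w - 1) * exp (- w)"
      by (rule mult_right_mono) simp
    also have "\<dots> = 2 * (1 - exp (- w))" by (simp add: algebra_simps flip: exp_add)
    finally have "a / s * (w / y * exp (- w)) \<le> a / s * (2 * (1 - exp (- w)))"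
      using a s by (intro mult_left_mono) auto
    also have "\<dots> = \<epsilon> * (1 - exp (- w))" using a \<epsilon> by (simp add: s_def)
    finally have "a / s * (w / y * exp (- w)) \<le> \<epsilon> * (1 - exp (- w))" .
    moreover have "y powr (- 1 - a) = w / y" using y by (simp add: w_def powr_diff powr_minus field_simps)
    ultimately show "(if 0 < x then a / s * (x / s) powr (- 1 - a) * exp (- ((x / s) powr (- a))) else 0)
        \<le> \<epsilon> * (1 - exp (- ((x / s) powr (- a))))"
      using x unfolding y_def[symmetric] w_def[symmetric] by simp
  qed (use \<epsilon> a s in auto)
  then show "hazard_rate_le \<epsilon> (frechet_pdf (2 + ln (real N), 2 * (2 + ln (real N)) / \<epsilon>, 0))"
    by (simp add: a_def s_def)
  assume N: "2 \<le> N"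
  show "\<exists>u v w. 0 \<le> u \<and> 0 \<le> v \<and> 0 \<le> w \<and>
      (\<integral>\<^sup>+x. ennreal (frechet_pdf (2 + ln (real N), 2 * (2 + ln (real N)) / \<epsilon>, 0) x) * ennreal (max (x - u) 0) \<partial>lborel) \<le> ennreal v \<and>
      (\<integral>\<^sup>+x. ennreal (frechet_pdf (2 + ln (real N), 2 * (2 + ln (real N)) / \<epsilon>, 0) x) * ennreal (max (- x) 0) \<partial>lborel) \<le> ennreal w \<and>
      u + real N * v + w \<le> 90 * ln (real N) / \<epsilon>"
    unfolding a_def[symmetric] s_def[symmetric]
  proof (rule power_law_excess_tuned[OF N \<epsilon>, where s = s, folded a_def])
    fix x assume x: "s \<le> x"
    \<comment> \<open>Dropping the exponential factor, which is at most 1, leaves the Pareto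
      density.\<close>
    have "a / s * (x / s) powr (- 1 - a) * exp (- ((x / s) powr (- a))) \<le> a / s * (x / s) powr (- 1 - a) * 1"
      using a s by (intro mult_left_mono) auto
    also have "\<dots> = a * s powr a * x powr (- a - 1)"
      using x s by (simp add: powr_divide powr_diff powr_minus field_simps)
    finally show "frechet_pdf (a, s, 0) x \<le> a * s powr a * x powr (- a - 1)"
      using x s by (simp add: pdf)
  qed (use s in \<open>auto simp: pdf s_def[symmetric]\<close>)
qed simp

theorem theorem2:
  shows "ftpl_achieves_bound gamma_pdf gamma_valid \<and>
         ftpl_achieves_bound gumbel_pdf gumbel_valid \<and>
         ftpl_achieves_bound frechet_pdf frechet_valid \<and>
         ftpl_achieves_bound weibull_pdf weibull_valid \<and>
         ftpl_achieves_bound pareto_pdf pareto_valid"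
  using gamma_achieves_bound gumbel_achieves_bound frechet_achieves_bound
    weibull_achieves_bound pareto_achieves_bound by blast

end
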